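(* Consider the fuzzy linear system $A\tilde{\mathbf z}=\tilde{\mathbf b}$ with $A\in\mathbb{R}^{m\times n}$ and let $SZ=B$ be the associated $2m\times 2n$ crisp system. If $S^{\{1,2,3\}}$ is a $\{1,2,3\}$-inverse of $S$, then the fuzzy linear system admits either a strong or a weak fuzzy least squares solution.
   Context: A fuzzy number in parametric form is a pair $(\underline a(\alpha),\overline a(\alpha))$, $0\le\alpha\le1$, with $\underline a$ bounded, left-continuous, non-decreasing, $\overline a$ bounded, left-continuous, non-increasing, and $\underline a(\alpha)\le\overline a(\alpha)$ for all $\alpha\in[0,1]$. A fuzzy linear system (FLS) is $A\tilde{\mathbf z}=\tilde{\mathbf b}$ with $A=(d_{ij})\in\mathbb{R}^{m\times n}$ a real matrix, $\tilde{\mathbf b}=(\tilde b_i)$, $\tilde b_i=(\underline b_i(\alpha),\overline b_i(\alpha))$, a given vector of fuzzy numbers, and $\tilde{\mathbf z}=(\tilde z_j)$ unknown. Associated crisp system $SZ=B$: $S=\begin{bmatrix} S_1 & S_2\\ S_2 & S_1\end{bmatrix}\in\mathbb{R}^{2m\times 2n}$, where $(S_1)_{ij}=d_{ij}$ if $d_{ij}\ge0$ and $0$ otherwise, $(S_2)_{ij}=-d_{ij}$ if $d_{ij}<0$ and $0$ otherwise; $Z=(\underline z_1,\dots,\underline z_n,-\overline z_1,\dots,-\overline z_n)^T$, $B=(\underline b_1,\dots,\underline b_m,-\overline b_1,\dots,-\overline b_m)^T$, all depending on $\alpha\in[0,1]$. A $\{1,2,3\}$-inverse of $S$ is a matrix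 $Y$ with $SYS=S$, $YSY=Y$, $(SY)^T=SY$. A least squares solution of $SZ=B$ is a $Z$ minimizing $\|SZ-B\|_2$ (for each $\alpha$). Given such a $Z$ with components $(\underline z_i(\alpha),\overline z_i(\alpha))$, put $\underline w_i(\alpha)=\min\{\underline z_i(\alpha),\overline z_i(\alpha),\underline z_i(1),\overline z_i(1)\}$ and $\overline w_i(\alpha)=\max\{\underline z_i(\alpha),\overline z_i(\alpha),\underline z_i(1),\overline z_i(1)\}$; then $W=\{(\underline w_i,\overline w_i)\}_{i=1}^n$ is the corresponding fuzzy least squares solution of the FLS. It is strong if all $(\underline z_i(\alpha),\overline z_i(\alpha))$ are fuzzy numbers (then $\underline w_i=\underline z_i$, $\overline w_i=\overline z_i$), and weak otherwise (a weak one need not be a fuzzy vector). *)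

theory Defs
  imports "HOL-Analysis.Analysis"
begin

text \<open>
  A pair of a lower and an upper branch. Only the values on the parameter interval
  \<open>{0..1}\<close> carry meaning.
\<close>

type_synonym branch_pair = "(real \<Rightarrow> real) \<times> (real \<Rightarrow> real)"

text \<open>
  Left-continuity at \<open>0\<close> is vacuous, since \<open>{0..1}\<close> has no points to the left of \<open>0\<close>.
\<close>

definition left_continuous_01 :: "(real \<Rightarrow> real) \<Rightarrow> bool" where
  "left_continuous_01 f \<longleftrightarrow> (\<forall>\<alpha>\<in>{0<..1}. continuous (at_left \<alpha>) f)"

definition fuzzy_number :: "branch_pair \<Rightarrow> bool" where
  "fuzzy_number a \<longleftrightarrow>
     bounded (fst a ` {0..1}) \<and> left_continuous_01 (fst a) \<and> mono_on {0..1} (fst a) \<and>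
     bounded (snd a ` {0..1}) \<and> left_continuous_01 (snd a) \<and> antimono_on {0..1} (snd a) \<and>
     (\<forall>\<alpha>\<in>{0..1}. fst a \<alpha> \<le> snd a \<alpha>)"

definition pos_part :: "real^'n^'m \<Rightarrow> real^'n^'m" where
  "pos_part A = (\<chi> i j. if A $ i $ j \<ge> 0 then A $ i $ j else 0)"

definition neg_part :: "real^'n^'m \<Rightarrow> real^'n^'m" where
  "neg_part A = (\<chi> i j. if A $ i $ j < 0 then - (A $ i $ j) else 0)"

text \<open>
  The index type \<open>'k + 'k\<close> has twice as many elements as \<open>'k\<close>; \<open>Inl\<close> and \<open>Inr\<close> address
  the first and the second block.
\<close>

definition crisp_matrix :: "real^'n^'m \<Rightarrow> real^('n + 'n)^('m + 'm)" where
  "crisp_matrix A = (\<chi> r c.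
     case (r, c) of
       (Inl i, Inl j) \<Rightarrow> pos_part A $ i $ j
     | (Inl i, Inr j) \<Rightarrow> neg_part A $ i $ j
     | (Inr i, Inl j) \<Rightarrow> neg_part A $ i $ j
     | (Inr i, Inr j) \<Rightarrow> pos_part A $ i $ j)"

text \<open>
  The vector of lower branches stacked on the negated upper branches. It yields both the
  unknown \<open>Z\<close> and the right-hand side \<open>B\<close> of the crisp system \<open>S Z = B\<close>; every function
  \<open>Z :: real \<Rightarrow> real^('k + 'k)\<close> is of the form \<open>stack z\<close>.
\<close>

definition stack :: "branch_pair^'k \<Rightarrow> real \<Rightarrow> real^('k + 'k)" where
  "stack z \<alpha> = (\<chi> r. case r of Inl i \<Rightarrow> fst (z $ i) \<alpha> | Inr i \<Rightarrow> - snd (z $ i) \<alpha>)"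

definition inverse_123 :: "real^'q^'p \<Rightarrow> real^'p^'q \<Rightarrow> bool" where
  "inverse_123 S Y \<longleftrightarrow>
     S ** Y ** S = S \<and> Y ** S ** Y = Y \<and> transpose (S ** Y) = S ** Y"

definition crisp_least_squares :: "real^'n^'m \<Rightarrow> branch_pair^'m \<Rightarrow> branch_pair^'n \<Rightarrow> bool" where
  "crisp_least_squares A b z \<longleftrightarrow>
     (\<forall>\<alpha>\<in>{0..1}. \<forall>v. norm (crisp_matrix A *v stack z \<alpha> - stack b \<alpha>)
                      \<le> norm (crisp_matrix A *v v - stack b \<alpha>))"

definition corresponding_solution :: "branch_pair^'n \<Rightarrow> branch_pair^'n" where
  "corresponding_solution z = (\<chi> i.
     (\<lambda>\<alpha>. Min {fst (z $ i) \<alpha>, snd (z $ i) \<alpha>, fst (z $ i) 1, snd (z $ i) 1},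
      \<lambda>\<alpha>. Max {fst (z $ i) \<alpha>, snd (z $ i) \<alpha>, fst (z $ i) 1, snd (z $ i) 1}))"

text \<open>
  \<open>w\<close> is the fuzzy least squares solution of the system \<open>(A, b)\<close> corresponding to \<open>z\<close>.
  Being strong or weak is a property of the underlying \<open>z\<close>, which is therefore kept as an
  argument: distinct \<open>z\<close> may have the same \<open>w\<close>.
\<close>

definition fuzzy_least_squares ::
  "real^'n^'m \<Rightarrow> branch_pair^'m \<Rightarrow> branch_pair^'n \<Rightarrow> branch_pair^'n \<Rightarrow> bool" where
  "fuzzy_least_squares A b z w \<longleftrightarrow>
     crisp_least_squares A b z \<and> w = corresponding_solution z"

definition strong_fuzzy_least_squares ::
  "real^'n^'m \<Rightarrow> branch_pair^'m \<Rightarrow> branch_pair^'n \<Rightarrow> branch_pair^'n \<Rightarrow> bool" where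
  "strong_fuzzy_least_squares A b z w \<longleftrightarrow>
     fuzzy_least_squares A b z w \<and> (\<forall>i. fuzzy_number (z $ i))"

definition weak_fuzzy_least_squares ::
  "real^'n^'m \<Rightarrow> branch_pair^'m \<Rightarrow> branch_pair^'n \<Rightarrow> branch_pair^'n \<Rightarrow> bool" where
  "weak_fuzzy_least_squares A b z w \<longleftrightarrow>
     fuzzy_least_squares A b z w \<and> \<not> (\<forall>i. fuzzy_number (z $ i))"

end

theory Submission
  imports Defs
begin

text \<open>
  If \<open>S ** Y ** S = S\<close> and \<open>S ** Y\<close> is symmetric, then \<open>S ** Y\<close> is the orthogonal projection
  onto the column space of \<open>S\<close>. Hence \<open>S *v (Y *v c)\<close> is the point of that space nearest to
  \<open>c\<close>, that is, \<open>Y *v c\<close> is a least squares solution of \<open>S *v x = c\<close>. Applied at each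
  parameter value to the stacked right-hand side, this gives a crisp least squares solution
  \<open>z\<close>, whose two branches are read off from the two blocks of the vector. The fuzzy solution
  corresponding to \<open>z\<close> is strong or weak according to whether all components of \<open>z\<close> are
  fuzzy numbers, and one of the two must occur.
\<close>

text \<open>
  The range of \<open>S\<close> is fixed by \<open>S ** Y\<close>, so symmetry moves the projection over to the
  residual \<open>S *v (Y *v c) - c\<close>, which it annihilates.
\<close>

lemma residual_orthogonal_range:
  fixes S :: "real^'q^'p" and Y :: "real^'p^'q"
  assumes SYS: "S ** Y ** S = S" and sym: "transpose (S ** Y) = S ** Y"
  shows "orthogonal (S *v u) (S *v (Y *v c) - c)"
proof -
  have fix_range: "(S ** Y) *v (S *v x) = S *v x" for x
    by (simp add: SYS matrix_vector_mul_assoc)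
  have "(S *v u) \<bullet> (S *v (Y *v c) - c) = ((S ** Y) *v (S *v u)) \<bullet> (S *v (Y *v c) - c)"
    by (simp add: fix_range)
  also have "\<dots> = (S *v u) \<bullet> ((S ** Y) *v (S *v (Y *v c) - c))"
    by (metis dot_lmul_matrix sym transpose_matrix_vector)
  also have "(S ** Y) *v (S *v (Y *v c) - c) = 0"
    by (simp only: matrix_vector_mult_diff_distrib fix_range)
       (simp add: matrix_vector_mul_assoc)
  finally show ?thesis
    by (simp add: orthogonal_def)
qed

lemma generalized_inverse_least_squares:
  fixes S :: "real^'q^'p" and Y :: "real^'p^'q"
  assumes "S ** Y ** S = S" and "transpose (S ** Y) = S ** Y"
  shows "norm (S *v (Y *v c) - c) \<le> norm (S *v v - c)"
proof -
  let ?r = "S *v (Y *v c) - c"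
  have "S *v v - c = S *v (v - Y *v c) + ?r"
    by (simp add: matrix_vector_mult_diff_distrib)
  then have "(norm (S *v v - c))\<^sup>2 = (norm (S *v (v - Y *v c)))\<^sup>2 + (norm ?r)\<^sup>2"
    by (simp only: norm_add_Pythagorean[OF residual_orthogonal_range[OF assms]])
  then have "(norm ?r)\<^sup>2 \<le> (norm (S *v v - c))\<^sup>2"
    by simp
  then show ?thesis
    by (rule power2_le_imp_le) simp
qed

lemma stack_surj: "\<exists>z. stack z = Z"
proof
  show "stack (\<chi> i. (\<lambda>\<alpha>. Z \<alpha> $ Inl i, \<lambda>\<alpha>. - Z \<alpha> $ Inr i)) = Z"
    by (auto simp: fun_eq_iff stack_def vec_eq_iff split: sum.split)
qed

theorem theorem3p9:
  fixes A :: "real^'n^'m"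
    and b :: "branch_pair^'m"
    and Y :: "real^('m + 'm)^('n + 'n)"
  assumes "\<forall>i. fuzzy_number (b $ i)"
    and "inverse_123 (crisp_matrix A) Y"
  shows "(\<exists>z w. strong_fuzzy_least_squares A b z w) \<or> (\<exists>z w. weak_fuzzy_least_squares A b z w)"
proof -
  obtain z :: "branch_pair^'n" where z: "stack z = (\<lambda>\<alpha>. Y *v stack b \<alpha>)"
    using stack_surj by blast
  have "crisp_least_squares A b z"
    using assms(2) generalized_inverse_least_squares[of "crisp_matrix A" Y]
    by (simp add: crisp_least_squares_def inverse_123_def z)
  then have "fuzzy_least_squares A b z (corresponding_solution z)"
    by (simp add: fuzzy_least_squares_def)
  then show ?thesis
    unfolding strong_fuzzy_least_squares_def weak_fuzzy_least_squares_def by blast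
qed

end
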